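(* Every solution $\Phi$ of $\mathcal E[\Phi]=0$ that is analytic at the origin $z=0$ with $\Phi(0)=1$ satisfies $$(5\Phi'(0)-1)(6\Phi'(0)-1)=0 .$$
   Context: For a function $\Phi$ of $z$, let $\theta=z\,\frac{d}{dz}$ and put $$A=(4+7\theta)\Phi,\qquad B=(3+7\theta)A,\qquad C=(2+7\theta)B.$$ The nonlinear third-order differential expression $\mathcal E$ is \begin{align*} \mathcal E[\Phi]={}&240+8C-72B+3B^2+48A-2AC\\ &+z\bigl[-512B+192AB+384A^2-48A^2B-48A^3+4A^3B\\ &\qquad+192\Phi B-768\Phi A+48\Phi A^2+240\Phi^2-24\Phi^2B+12\Phi^2A\bigr]\\ &+z^2\bigl[512A^3-192A^4+24A^5-A^6-1536\Phi A^2+384\Phi A^3-24\Phi A^4\\ &\qquad+1536\Phi^2A-192\Phi^2A^2-512\Phi^3-32\Phi^3A+4\Phi^3A^2+36\Phi^4\bigr]. \end{align*} *)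

theory Defs
  imports "HOL-Analysis.Analysis"
begin

definition theta :: "(complex \<Rightarrow> complex) \<Rightarrow> complex \<Rightarrow> complex" where
  "theta f = (\<lambda>z. z * deriv f z)"

definition A_of :: "(complex \<Rightarrow> complex) \<Rightarrow> complex \<Rightarrow> complex" where
  "A_of \<Phi> = (\<lambda>z. 4 * \<Phi> z + 7 * theta \<Phi> z)"

definition B_of :: "(complex \<Rightarrow> complex) \<Rightarrow> complex \<Rightarrow> complex" where
  "B_of \<Phi> = (\<lambda>z. 3 * A_of \<Phi> z + 7 * theta (A_of \<Phi>) z)"

definition C_of :: "(complex \<Rightarrow> complex) \<Rightarrow> complex \<Rightarrow> complex" where
  "C_of \<Phi> = (\<lambda>z. 2 * B_of \<Phi> z + 7 * theta (B_of \<Phi>) z)"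

definition E_expr :: "(complex \<Rightarrow> complex) \<Rightarrow> complex \<Rightarrow> complex" where
  "E_expr \<Phi> z =
    (let F = \<Phi> z; A = A_of \<Phi> z; B = B_of \<Phi> z; C = C_of \<Phi> z in
      240 + 8*C - 72*B + 3*B^2 + 48*A - 2*A*C
      + z * (- 512*B + 192*A*B + 384*A^2 - 48*A^2*B - 48*A^3 + 4*A^3*B
             + 192*F*B - 768*F*A + 48*F*A^2 + 240*F^2 - 24*F^2*B + 12*F^2*A)
      + z^2 * (512*A^3 - 192*A^4 + 24*A^5 - A^6 - 1536*F*A^2 + 384*F*A^3 - 24*F*A^4
             + 1536*F^2*A - 192*F^2*A^2 - 512*F^3 - 32*F^3*A + 4*F^3*A^2 + 36*F^4))"

end

theory Submission
  imports Defs "HOL-Complex_Analysis.Complex_Analysis"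
begin

text \<open>
  Write \<open>\<Phi>(z) = 1 + a z + b z\<^sup>2 + \<dots>\<close>. As \<open>c + 7\<theta>\<close> multiplies \<open>z\<^sup>n\<close> by \<open>c + 7 n\<close>, the values of
  \<open>A\<close>, \<open>B\<close>, \<open>C\<close> at the origin are \<open>4\<close>, \<open>12\<close>, \<open>24\<close> and their derivatives there are \<open>11 a\<close>, \<open>110 a\<close>,
  \<open>990 a\<close> (lemma \<open>theta_affine_at_0\<close>). The equation degenerates at these values: the part of
  \<open>\<E>[\<Phi>]\<close> without an explicit factor \<open>z\<close> is
  \<open>3 (B - 12)\<^sup>2 - 2 (A - 4) (C - 24)\<close>,
  which vanishes to second order at the origin, and the coefficient of \<open>z\<close> (\<open>linear_part\<close> below)
  vanishes at \<open>(\<Phi>, A, B) = (1, 4, 12)\<close>. Hence \<open>\<E>[\<Phi>]\<close> is divisible by \<open>z\<^sup>2\<close> whatever \<open>a\<close> is, and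
  the first condition on \<open>\<Phi>\<close> comes from the limit of \<open>\<E>[\<Phi>](z) / z\<^sup>2\<close> as \<open>z \<rightarrow> 0\<close>. This limit involves
  first derivatives at the origin only, so that \<open>b\<close> does not occur in it, and it equals
  \<open>484 (30 a\<^sup>2 - 11 a + 1) = 484 (5 a - 1) (6 a - 1)\<close>.
\<close>

lemma theta_affine_at_0:
  assumes "f analytic_on {0}" and g_def: "g = (\<lambda>z. c * f z + d * theta f z)"
  shows "g analytic_on {0}" "g 0 = c * f 0" "deriv g 0 = (c + d) * deriv f 0"
proof -
  have f': "deriv f analytic_on {0}"
    using assms(1) by (rule analytic_deriv)
  show "g analytic_on {0}"
    unfolding g_def theta_def by (intro analytic_intros assms(1) f')
  show "g 0 = c * f 0"
    by (simp add: g_def theta_def)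
  have 1: "(f has_field_derivative deriv f 0) (at 0)"
    using assms(1) by (simp add: analytic_on_imp_differentiable_at DERIV_deriv_iff_field_differentiable)
  have 2: "(deriv f has_field_derivative deriv (deriv f) 0) (at 0)"
    using f' by (simp add: analytic_on_imp_differentiable_at DERIV_deriv_iff_field_differentiable)
  have "(g has_field_derivative (c + d) * deriv f 0) (at 0)"
    unfolding g_def theta_def
    by (rule derivative_eq_intros 1 2 refl | simp add: algebra_simps)+
  then show "deriv g 0 = (c + d) * deriv f 0"
    by (rule DERIV_imp_deriv)
qed

definition linear_part :: "complex \<Rightarrow> complex \<Rightarrow> complex \<Rightarrow> complex" where
  "linear_part F A B =
     - 512*B + 192*A*B + 384*A^2 - 48*A^2*B - 48*A^3 + 4*A^3*B
     + 192*F*B - 768*F*A + 48*F*A^2 + 240*F^2 - 24*F^2*B + 12*F^2*A"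

definition quadratic_part :: "complex \<Rightarrow> complex \<Rightarrow> complex" where
  "quadratic_part F A =
     512*A^3 - 192*A^4 + 24*A^5 - A^6 - 1536*F*A^2 + 384*F*A^3 - 24*F*A^4
     + 1536*F^2*A - 192*F^2*A^2 - 512*F^3 - 32*F^3*A + 4*F^3*A^2 + 36*F^4"

text \<open>
  The constants \<open>12\<close>, \<open>4\<close>, \<open>24\<close> are the values \<open>B(0)\<close>, \<open>A(0)\<close>, \<open>C(0)\<close> for \<open>\<Phi>(0) = 1\<close>, so the first
  two terms are products of functions vanishing at the origin.
\<close>

lemma E_expr_split:
  "E_expr \<Phi> z =
     3 * (B_of \<Phi> z - 12)^2 - 2 * (A_of \<Phi> z - 4) * (C_of \<Phi> z - 24)
     + z * linear_part (\<Phi> z) (A_of \<Phi> z) (B_of \<Phi> z) + z^2 * quadratic_part (\<Phi> z) (A_of \<Phi> z)"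
  unfolding E_expr_def Let_def linear_part_def[symmetric] quadratic_part_def[symmetric]
  by (simp add: power2_eq_square algebra_simps)

text \<open>
  Chain rule: the gradient of \<open>linear_part\<close> at \<open>(1, 4, 12)\<close> is \<open>(0, 396, -88)\<close>. As \<open>linear_part\<close>
  itself vanishes there, this derivative is also the limit of its value along the curve divided
  by \<open>z\<close>.
\<close>

lemma has_field_derivative_linear_part:
  assumes "(F has_field_derivative F') (at 0)" "(A has_field_derivative A') (at 0)"
    "(B has_field_derivative B') (at 0)"
    and "F 0 = 1" "A 0 = 4" "B 0 = 12"
  shows "((\<lambda>z. linear_part (F z) (A z) (B z)) has_field_derivative 396 * A' - 88 * B') (at 0)"
  unfolding linear_part_def
  by (rule derivative_eq_intros assms(1-3) refl | simp add: assms(4-6) algebra_simps)+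

lemma tendsto_E_expr_over_square:
  assumes "\<Phi> analytic_on {0}" "\<Phi> 0 = 1"
  defines "a \<equiv> deriv \<Phi> 0"
  shows "((\<lambda>z. E_expr \<Phi> z / z^2) \<longlongrightarrow> 484 * ((5 * a - 1) * (6 * a - 1))) (at 0)"
proof -
  define A B C where "A = A_of \<Phi>" and "B = B_of \<Phi>" and "C = C_of \<Phi>"
  note A = theta_affine_at_0[OF assms(1) A_of_def, folded A_def]
  note B = theta_affine_at_0[OF A(1) B_of_def[of \<Phi>, folded A_def], folded B_def]
  note C = theta_affine_at_0[OF B(1) C_of_def[of \<Phi>, folded B_def], folded C_def]
  have values_at_0: "A 0 = 4" "B 0 = 12" "C 0 = 24"
    using A(2) B(2) C(2) assms(2) by simp_all
  have derivs_at_0: "deriv A 0 = 11 * a" "deriv B 0 = 110 * a" "deriv C 0 = 990 * a"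
    using A(3) B(3) C(3) by (simp_all add: a_def)
  have D: "(f has_field_derivative deriv f 0) (at 0)" if "f analytic_on {0}" for f :: "complex \<Rightarrow> complex"
    using that by (simp add: analytic_on_imp_differentiable_at DERIV_deriv_iff_field_differentiable)
  define P where "P = (\<lambda>z. linear_part (\<Phi> z) (A z) (B z))"
  define Q where "Q = (\<lambda>z. quadratic_part (\<Phi> z) (A z))"
  have P0: "P 0 = 0"
    by (simp add: P_def linear_part_def values_at_0 assms(2))
  have "(P has_field_derivative - 5324 * a) (at 0)"
    using has_field_derivative_linear_part[OF D[OF assms(1)] D[OF A(1)] D[OF B(1)] assms(2) values_at_0(1,2)]
    by (simp add: P_def derivs_at_0)
  then have limP: "((\<lambda>z. P z / z) \<longlongrightarrow> - 5324 * a) (at 0)"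
    by (simp add: has_field_derivative_iff P0)
  have "isCont \<Phi> 0" "isCont A 0"
    using assms(1) A(1) by (auto intro: analytic_at_imp_isCont)
  then have "isCont Q 0"
    unfolding Q_def quadratic_part_def by (intro continuous_intros)
  moreover have "Q 0 = 484"
    by (simp add: Q_def quadratic_part_def values_at_0 assms(2))
  ultimately have limQ: "(Q \<longlongrightarrow> 484) (at 0)"
    by (metis isCont_def)
  have limA: "((\<lambda>z. (A z - 4) / z) \<longlongrightarrow> 11 * a) (at 0)"
   and limB: "((\<lambda>z. (B z - 12) / z) \<longlongrightarrow> 110 * a) (at 0)"
   and limC: "((\<lambda>z. (C z - 24) / z) \<longlongrightarrow> 990 * a) (at 0)"
    using D[OF A(1)] D[OF B(1)] D[OF C(1)]
    by (simp_all add: has_field_derivative_iff values_at_0 derivs_at_0)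
  \<comment> \<open>For \<open>z \<noteq> 0\<close> this is \<open>E_expr \<Phi> z / z\<^sup>2\<close>, with one factor \<open>1 / z\<close> given to each quantity that
      vanishes at the origin, which turns these quantities into difference quotients.\<close>
  let ?q = "\<lambda>z. 3 * ((B z - 12) / z)^2 - 2 * ((A z - 4) / z) * ((C z - 24) / z) + P z / z + Q z"
  have lim_q: "(?q \<longlongrightarrow> 3 * (110 * a)^2 - 2 * (11 * a) * (990 * a) + - 5324 * a + 484) (at 0)"
    by (intro tendsto_intros limA limB limC limP limQ)
  have factored: "3 * (110 * a)^2 - 2 * (11 * a) * (990 * a) + - 5324 * a + 484
      = 484 * ((5 * a - 1) * (6 * a - 1))"
    by (simp add: power2_eq_square algebra_simps)
  have "eventually (\<lambda>z. ?q z = E_expr \<Phi> z / z^2) (at 0)"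
    unfolding eventually_at_filter
    by (rule always_eventually)
       (auto simp: E_expr_split A_def B_def C_def P_def Q_def power2_eq_square field_simps)
  with lim_q show ?thesis
    unfolding factored by (rule Lim_transform_eventually)
qed

theorem proposition6p1:
  fixes \<Phi> :: "complex \<Rightarrow> complex"
  assumes "\<Phi> analytic_on {0}"
    and "\<forall>\<^sub>F z in nhds 0. E_expr \<Phi> z = 0"
    and "\<Phi> 0 = 1"
  shows "(5 * deriv \<Phi> 0 - 1) * (6 * deriv \<Phi> 0 - 1) = 0"
proof -
  have "\<forall>\<^sub>F z in at 0. E_expr \<Phi> z / z^2 = 0"
    using assms(2) by (auto simp: eventually_at_filter elim: eventually_mono)
  then have "((\<lambda>z. E_expr \<Phi> z / z^2) \<longlongrightarrow> 0) (at 0)"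
    by (rule tendsto_eventually)
  with tendsto_E_expr_over_square[OF assms(1,3)]
  have "484 * ((5 * deriv \<Phi> 0 - 1) * (6 * deriv \<Phi> 0 - 1)) = 0"
    by (rule tendsto_unique[rotated]) simp
  then show ?thesis
    by simp
qed

end
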